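(* Let $m\geq 5$ be an integer and let $G\in RHL_m$ be any $m$-dimensional restricted hypercube-like graph. Then $fsmp(G)=m$.
   Context: For disjoint graphs $G_0,G_1$ of the same order and a bijection $\phi:V(G_0)\to V(G_1)$, $G_0\oplus_\phi G_1$ is the graph with vertex set $V(G_0)\cup V(G_1)$ and edge set $E(G_0)\cup E(G_1)\cup\{v\phi(v): v\in V(G_0)\}$. $G(8,4)$ is the graph with vertex set $\{v_0,\dots,v_7\}$ and edges $v_iv_j$ whenever $j\equiv i+1$ or $j\equiv i+4 \pmod 8$. The restricted hypercube-like graphs: $RHL_3=\{G(8,4)\}$ (up to isomorphism) and, for $m\geq 4$, $RHL_m=\{G_0\oplus_\phi G_1 : G_0,G_1\in RHL_{m-1},\ \phi \text{ a bijection}\}$. A fractional perfect matching of a graph $H$ is a function $f:E(H)\to[0,1]$ with $\sum_{e\ni v}f(e)=1$ for every vertex $v$. A set $F$ of vertices and/or edges of $H$ is a fractional strong matching preclusion (FSMP) set if $H-F$ (deleting the vertices with their incident edges, and the edges) has no fractional perfect matching; $fsmp(H)$ is the minimum size of an FSMP set. *)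

theory Defs
  imports Complex_Main "HOL-Number_Theory.Cong"
begin

record 'a ugraph =
  verts :: "'a set"
  edges :: "'a set set"

definition isomorphic :: "'a ugraph \<Rightarrow> 'b ugraph \<Rightarrow> bool" where
  "isomorphic G H \<longleftrightarrow>
     (\<exists>f. bij_betw f (verts G) (verts H) \<and> edges H = (\<lambda>e. f ` e) ` edges G)"

definition G84 :: "nat ugraph" where
  "G84 = \<lparr> verts = {0..<8},
           edges = {{i, j} | i j. i < 8 \<and> j < 8 \<and> ([j = i + 1] (mod 8) \<or> [j = i + 4] (mod 8))} \<rparr>"

definition oplus_graph :: "('a \<Rightarrow> 'a) \<Rightarrow> 'a ugraph \<Rightarrow> 'a ugraph \<Rightarrow> 'a ugraph" where
  "oplus_graph \<phi> G0 G1 =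
     \<lparr> verts = verts G0 \<union> verts G1,
       edges = edges G0 \<union> edges G1 \<union> {{v, \<phi> v} | v. v \<in> verts G0} \<rparr>"

text \<open>Since the base case admits every copy of \<^const>\<open>G84\<close> on vertices of the given type,
  each level contains every isomorphic copy of its members.\<close>

inductive RHL :: "nat \<Rightarrow> 'a ugraph \<Rightarrow> bool" where
  base: "isomorphic G84 G \<Longrightarrow> RHL 3 G"
| step: "\<lbrakk> RHL m G0; RHL m G1; verts G0 \<inter> verts G1 = {}; bij_betw \<phi> (verts G0) (verts G1) \<rbrakk>
         \<Longrightarrow> RHL (Suc m) (oplus_graph \<phi> G0 G1)"

definition fractional_perfect_matching :: "'a ugraph \<Rightarrow> ('a set \<Rightarrow> real) \<Rightarrow> bool" where
  "fractional_perfect_matching H f \<longleftrightarrow>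
     (\<forall>e \<in> edges H. f e \<in> {0..1}) \<and>
     (\<forall>v \<in> verts H. (\<Sum>e \<in> {e \<in> edges H. v \<in> e}. f e) = 1)"

text \<open>A mixed set of vertices and edges is a set over the sum type:
  \<^term>\<open>Inl v\<close> stands for the vertex \<^term>\<open>v\<close>, \<^term>\<open>Inr e\<close> for the edge \<^term>\<open>e\<close>.\<close>

definition delete :: "'a ugraph \<Rightarrow> ('a + 'a set) set \<Rightarrow> 'a ugraph" where
  "delete H F =
     \<lparr> verts = {v \<in> verts H. Inl v \<notin> F},
       edges = {e \<in> edges H. Inr e \<notin> F \<and> (\<forall>v \<in> e. Inl v \<notin> F)} \<rparr>"

definition FSMP_set :: "'a ugraph \<Rightarrow> ('a + 'a set) set \<Rightarrow> bool" where
  "FSMP_set H F \<longleftrightarrow>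
     F \<subseteq> verts H <+> edges H \<and> (\<nexists>f. fractional_perfect_matching (delete H F) f)"

text \<open>Finiteness of \<^term>\<open>F\<close> is automatic for finite graphs; it keeps infinite sets,
  whose \<^const>\<open>card\<close> is 0, from counting.\<close>

definition fsmp :: "'a ugraph \<Rightarrow> nat" where
  "fsmp H = (LEAST k. \<exists>F. finite F \<and> FSMP_set H F \<and> card F = k)"

end

theory Submission imports Defs
begin

text \<open>The edges at a vertex form an FSMP set of size at most \<open>m\<close>. For the lower bound, split
  \<open>G\<close> into \<open>G\<^sub>0 \<oplus> G\<^sub>1\<close>. If both halves survive their own faults, so does \<open>G\<close>.
  If all \<open>m - 1\<close> faults lie in one half, forget one fault there, take a fractional perfect
  matching, and move the weight on the forgotten vertex or edge to the cross edges; the other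
  half is then asked for a convex combination of demands missing at most two vertices.
  The induction cannot start at \<open>G(8,4)\<close>, where one vertex and one edge may already be
  an FSMP set. It therefore carries a weaker invariant through dimensions 3 and 4: a bad
  set of \<open>m - 1\<close> faults contains exactly one vertex and is repaired by deleting any one
  of at least two further vertices, which can be matched across instead. In dimension 5 the
  other half has enough slack to absorb this extra vertex, so the exception disappears.\<close>

section \<open>Realizable vertex demands\<close>

text \<open>Weights form a symmetric matrix rather than a function on edges, so vertex sums range
  over \<open>V\<close> and rerouting weight is matrix arithmetic. Demands are arbitrary reals
  because restoring a forgotten fault leaves fractional deficits; the realizable demands form a
  convex cone.\<close>

definition realizable :: "'a set \<Rightarrow> 'a set set \<Rightarrow> ('a \<Rightarrow> real) \<Rightarrow> bool" where
  "realizable V D b \<longleftrightarrow>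
     (\<exists>w. (\<forall>u v. 0 \<le> w u v \<and> w u v = w v u \<and> (w u v \<noteq> 0 \<longrightarrow> {u, v} \<in> D)) \<and>
          (\<forall>u\<in>V. (\<Sum>v\<in>V. w u v) = b u))"

lemma realizableI:
  assumes "\<And>u v. 0 \<le> w u v" "\<And>u v. w u v = w v u" "\<And>u v. w u v \<noteq> 0 \<Longrightarrow> {u, v} \<in> D"
    and "\<And>u. u \<in> V \<Longrightarrow> (\<Sum>v\<in>V. w u v) = b u"
  shows "realizable V D b"
  unfolding realizable_def using assms by (intro exI[of _ w]) blast

lemma realizableE:
  assumes "realizable V D b"
  obtains w where "\<And>u v. 0 \<le> w u v" "\<And>u v. w u v = w v u"
    "\<And>u v. w u v \<noteq> 0 \<Longrightarrow> {u, v} \<in> D" "\<And>u. u \<in> V \<Longrightarrow> (\<Sum>v\<in>V. w u v) = b u"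
  using assms unfolding realizable_def by blast

lemma realizable_cong:
  assumes "realizable V D b" "\<And>v. v \<in> V \<Longrightarrow> b v = b' v"
  shows "realizable V D b'"
  using assms unfolding realizable_def by metis

lemma realizable_mono:
  assumes "realizable V D b" "D \<subseteq> D'"
  shows "realizable V D' b"
  using assms unfolding realizable_def by blast

lemma realizable_zero: "realizable V D (\<lambda>_. 0)"
  by (rule realizableI[of "\<lambda>_ _. 0"]) auto

lemma realizable_add:
  assumes "realizable V D b" "realizable V D c"
  shows "realizable V D (\<lambda>v. b v + c v)"
proof -
  obtain w where w: "\<And>u v. 0 \<le> w u v" "\<And>u v. w u v = w v u"
    "\<And>u v. w u v \<noteq> 0 \<Longrightarrow> {u, v} \<in> D" "\<And>u. u \<in> V \<Longrightarrow> (\<Sum>v\<in>V. w u v) = b u"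
    using assms(1) by (rule realizableE) blast
  obtain x where x: "\<And>u v. 0 \<le> x u v" "\<And>u v. x u v = x v u"
    "\<And>u v. x u v \<noteq> 0 \<Longrightarrow> {u, v} \<in> D" "\<And>u. u \<in> V \<Longrightarrow> (\<Sum>v\<in>V. x u v) = c u"
    using assms(2) by (rule realizableE) blast
  show ?thesis
  proof (rule realizableI[of "\<lambda>u v. w u v + x u v"])
    show "w u v + x u v = w v u + x v u" for u v
      using w(2)[of u v] x(2)[of u v] by simp
    show "w u v + x u v \<noteq> 0 \<Longrightarrow> {u, v} \<in> D" for u v
      using w(3)[of u v] x(3)[of u v] by fastforce
  qed (auto simp: w x sum.distrib)
qed

lemma realizable_scale:
  assumes "realizable V D b" "0 \<le> t"
  shows "realizable V D (\<lambda>v. t * b v)"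
proof -
  obtain w where w: "\<And>u v. 0 \<le> w u v" "\<And>u v. w u v = w v u"
    "\<And>u v. w u v \<noteq> 0 \<Longrightarrow> {u, v} \<in> D" "\<And>u. u \<in> V \<Longrightarrow> (\<Sum>v\<in>V. w u v) = b u"
    using assms(1) by (rule realizableE) blast
  show ?thesis
  proof (rule realizableI[of "\<lambda>u v. t * w u v"])
    show "t * w u v = t * w v u" for u v
      using w(2)[of u v] by simp
  qed (use assms(2) w in \<open>auto simp flip: sum_distrib_left\<close>)
qed

lemma realizable_sum:
  assumes "\<And>i. i \<in> I \<Longrightarrow> realizable V D (b i)"
  shows "realizable V D (\<lambda>v. \<Sum>i\<in>I. b i v)"
  using assms
proof (induction I rule: infinite_finite_induct)
  case (insert i I)
  then show ?case by (simp add: realizable_add)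
qed (simp_all add: realizable_zero)

text \<open>Padding with zero weights turns a solution on one half of a join into a partial solution
  on the whole, ready to be added to others.\<close>

lemma realizable_extend:
  assumes "realizable W D b" "W \<subseteq> V" "finite V"
  shows "realizable V D (\<lambda>v. if v \<in> W then b v else 0)"
proof -
  obtain w where w: "\<And>u v. 0 \<le> w u v" "\<And>u v. w u v = w v u"
    "\<And>u v. w u v \<noteq> 0 \<Longrightarrow> {u, v} \<in> D" "\<And>u. u \<in> W \<Longrightarrow> (\<Sum>v\<in>W. w u v) = b u"
    using assms(1) by (rule realizableE) blast
  show ?thesis
  proof (rule realizableI[of "\<lambda>u v. if u \<in> W \<and> v \<in> W then w u v else 0"])
    show "(\<Sum>v\<in>V. if u \<in> W \<and> v \<in> W then w u v else 0) = (if u \<in> W then b u else 0)" for u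
      using assms(2,3) w(4)[of u] by (simp add: sum.inter_restrict[symmetric] Int_absorb1)
  qed (use w in \<open>auto split: if_splits\<close>)
qed

lemma realizable_edge:
  assumes "u \<in> V" "v \<in> V" "u \<noteq> v" "{u, v} \<in> D" "0 \<le> c" "finite V"
  shows "realizable V D (\<lambda>x. if x = u \<or> x = v then c else 0)"
proof (rule realizableI[of "\<lambda>x y. if {x, y} = {u, v} then c else 0"])
  fix x assume "x \<in> V"
  have "(\<Sum>y\<in>V. if {x, y} = {u, v} then c else 0) =
        (\<Sum>y\<in>V. if x = u \<and> y = v \<or> x = v \<and> y = u then c else 0)"
    by (simp add: doubleton_eq_iff)
  also have "\<dots> = (if x = u \<or> x = v then c else 0)"
    using assms by (cases "x = u"; cases "x = v") auto
  finally show "(\<Sum>y\<in>V. if {x, y} = {u, v} then c else 0) = (if x = u \<or> x = v then c else 0)" .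
qed (use assms in \<open>auto simp: insert_commute split: if_splits\<close>)

lemma realizable_edge_list:
  assumes "finite V"
    and "\<And>c u v. (c, u, v) \<in> set L \<Longrightarrow> 0 \<le> c \<and> u \<in> V \<and> v \<in> V \<and> u \<noteq> v \<and> {u, v} \<in> D"
  shows "realizable V D (\<lambda>x. \<Sum>(c, u, v)\<leftarrow>L. if x = u \<or> x = v then c else 0)"
  using assms(2)
proof (induction L)
  case Nil
  then show ?case by (simp add: realizable_zero)
next
  case (Cons a L)
  obtain c u v where a: "a = (c, u, v)" by (cases a)
  have "realizable V D (\<lambda>x. if x = u \<or> x = v then c else 0)"
    using Cons.prems[of c u v] assms(1) by (intro realizable_edge) (auto simp: a)
  moreover have "realizable V D (\<lambda>x. \<Sum>(c, u, v)\<leftarrow>L. if x = u \<or> x = v then c else 0)"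
    by (intro Cons.IH Cons.prems) simp
  ultimately show ?case by (simp add: a realizable_add)
qed


section \<open>Fault sets and fractional perfect matchings\<close>

definition wf_graph :: "'a ugraph \<Rightarrow> bool" where
  "wf_graph G \<longleftrightarrow> finite (verts G) \<and>
     (\<forall>e\<in>edges G. \<exists>u\<in>verts G. \<exists>v\<in>verts G. u \<noteq> v \<and> e = {u, v})"

text \<open>A deleted vertex keeps its place with demand 0, which forces every weight between it and
  a vertex of \<open>G\<close> to vanish. All fault sets thus share one vertex set, and their
  solutions can be combined.\<close>

definition good :: "'a ugraph \<Rightarrow> 'a set \<Rightarrow> 'a set set \<Rightarrow> bool" where
  "good G X Y \<longleftrightarrow> realizable (verts G) (edges G - Y) (\<lambda>v. of_bool (v \<notin> X))"

lemma good_cong: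
  assumes "good G X Y" "X \<inter> verts G = X' \<inter> verts G" "Y \<inter> edges G = Y' \<inter> edges G"
  shows "good G X' Y'"
proof -
  have "edges G - Y = edges G - Y'" using assms(3) by blast
  then show ?thesis
    using assms(1,2) unfolding good_def by (auto elim!: realizable_cong)
qed

lemma wf_graph_finite_edges:
  assumes "wf_graph G"
  shows "finite (edges G)"
proof (rule finite_subset)
  show "edges G \<subseteq> Pow (verts G)" using assms by (auto simp: wf_graph_def)
  show "finite (Pow (verts G))" using assms by (simp add: wf_graph_def)
qed

lemma wf_graph_edgeD:
  assumes "wf_graph G" "{u, v} \<in> edges G"
  shows "u \<in> verts G" "v \<in> verts G" "u \<noteq> v"
  using assms by (force simp: wf_graph_def doubleton_eq_iff)+

lemma good_imp_fractional_perfect_matching: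
  assumes wf: "wf_graph G" and "good G {v. Inl v \<in> F} {e. Inr e \<in> F}"
  shows "\<exists>f. fractional_perfect_matching (delete G F) f"
proof -
  let ?V = "verts G" and ?H = "delete G F"
  have fin: "finite ?V" using wf by (simp add: wf_graph_def)
  obtain w :: "'a \<Rightarrow> 'a \<Rightarrow> real" where w0: "\<And>u v. 0 \<le> w u v" and wsym: "\<And>u v. w u v = w v u"
    and wE: "\<And>u v. w u v \<noteq> 0 \<Longrightarrow> {u, v} \<in> edges G - {e. Inr e \<in> F}"
    and wsum: "\<And>u. u \<in> ?V \<Longrightarrow> (\<Sum>v\<in>?V. w u v) = of_bool (u \<notin> {v. Inl v \<in> F})"
    using assms(2) unfolding good_def by (rule realizableE) blast
  \<comment> \<open>A single weight is at most the vertex sum containing it: at most 1, and 0 at a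
    deleted vertex.\<close>
  have le: "w u v \<le> of_bool (Inl u \<notin> F)" if "u \<in> ?V" "v \<in> ?V" for u v
    using member_le_sum[of v ?V "w u"] wsum[OF that(1)] that fin w0 by auto
  \<comment> \<open>Symmetry of \<open>w\<close> makes the value independent of the order of the
    endpoints.\<close>
  define f where "f e = (THE t. \<exists>u v. e = {u, v} \<and> t = w u v)" for e
  have f: "f {u, v} = w u v" for u v
    unfolding f_def by (rule the_equality) (auto simp: doubleton_eq_iff wsym)
  have "fractional_perfect_matching ?H f"
    unfolding fractional_perfect_matching_def
  proof (intro conjI ballI)
    fix e assume "e \<in> edges ?H"
    then obtain u v where uv: "u \<in> ?V" "v \<in> ?V" "e = {u, v}"
      using wf by (auto simp: delete_def wf_graph_def)
    have "w u v \<le> 1" using le[OF uv(1,2)] by (auto split: if_splits simp: of_bool_def)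
    then show "f e \<in> {0..1}" using w0 by (simp add: uv(3) f)
  next
    fix v assume v: "v \<in> verts ?H"
    then have vV: "v \<in> ?V" and vF: "Inl v \<notin> F" by (auto simp: delete_def)
    define N where "N = {u \<in> ?V. {v, u} \<in> edges ?H}"
    have "{e \<in> edges ?H. v \<in> e} = (\<lambda>u. {v, u}) ` N"
    proof
      show "{e \<in> edges ?H. v \<in> e} \<subseteq> (\<lambda>u. {v, u}) ` N"
      proof
        fix e assume e: "e \<in> {e \<in> edges ?H. v \<in> e}"
        then have "e \<in> edges G" by (simp add: delete_def)
        then obtain a b where "a \<in> ?V" "b \<in> ?V" "e = {a, b}"
          using wf by (auto simp: wf_graph_def)
        with e obtain u where "u \<in> ?V" "e = {v, u}" by auto
        with e show "e \<in> (\<lambda>u. {v, u}) ` N" by (auto simp: N_def)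
      qed
    qed (auto simp: N_def)
    moreover have "inj_on (\<lambda>u. {v, u}) N" by (auto simp: inj_on_def doubleton_eq_iff)
    ultimately have "(\<Sum>e\<in>{e \<in> edges ?H. v \<in> e}. f e) = (\<Sum>u\<in>N. w v u)"
      by (simp add: sum.reindex f)
    \<comment> \<open>Passing from \<open>N\<close> to all vertices adds only zeros: a nonzero
      weight forces the edge to survive and its other end to be healthy.\<close>
    also have "\<dots> = (\<Sum>u\<in>?V. w v u)"
    proof (rule sum.mono_neutral_left[OF fin])
      show "\<forall>u\<in>?V - N. w v u = 0"
      proof
        fix u assume u: "u \<in> ?V - N"
        show "w v u = 0"
        proof (rule ccontr)
          assume nz: "w v u \<noteq> 0"
          have "w u v \<le> of_bool (Inl u \<notin> F)" using le u vV by blast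
          with nz w0[of u v] wsym[of u v] have "Inl u \<notin> F" by (auto simp: of_bool_def split: if_splits)
          with wE[OF nz] vF have "{v, u} \<in> edges ?H" by (auto simp: delete_def)
          with u show False by (simp add: N_def)
        qed
      qed
    qed (auto simp: N_def)
    also have "\<dots> = 1" using wsum[OF vV] vF by simp
    finally show "(\<Sum>e\<in>{e \<in> edges ?H. v \<in> e}. f e) = 1" .
  qed
  then show ?thesis by blast
qed

definition robust :: "'a ugraph \<Rightarrow> nat \<Rightarrow> bool" where
  "robust G k \<longleftrightarrow>
     (\<forall>X Y. X \<subseteq> verts G \<longrightarrow> Y \<subseteq> edges G \<longrightarrow> card X + card Y \<le> k \<longrightarrow> good G X Y)"

text \<open>Two distinct repairs are demanded so that one further fault, at a partner vertex or on a
  cross edge, cannot block both.\<close>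

definition nearly_good :: "'a ugraph \<Rightarrow> 'a set \<Rightarrow> 'a set set \<Rightarrow> bool" where
  "nearly_good G X Y \<longleftrightarrow>
     (\<exists>a b. a \<in> verts G - X \<and> b \<in> verts G - X \<and> a \<noteq> b \<and>
            good G (insert a X) Y \<and> good G (insert b X) Y)"

text \<open>The exceptional shape is pinned down exactly, so that it can be avoided by choosing
  which fault to forget.\<close>

definition nearly_robust :: "'a ugraph \<Rightarrow> nat \<Rightarrow> bool" where
  "nearly_robust G k \<longleftrightarrow>
     (\<forall>X Y. X \<subseteq> verts G \<longrightarrow> Y \<subseteq> edges G \<longrightarrow> card X + card Y \<le> k \<longrightarrow>
        good G X Y \<or> card X = 1 \<and> card Y = k - 1 \<and> nearly_good G X Y)"

text \<open>Counting only the faults inside \<open>G\<close> lets the fault sets of a join be passed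
  unchanged to either half.\<close>

lemma nearly_robustD:
  assumes "nearly_robust G k" "wf_graph G" "card (X \<inter> verts G) + card (Y \<inter> edges G) \<le> k"
  shows "good G X Y \<or>
    card (X \<inter> verts G) = 1 \<and> card (Y \<inter> edges G) = k - 1 \<and> nearly_good G X Y"
proof -
  let ?X = "X \<inter> verts G" and ?Y = "Y \<inter> edges G"
  have "good G ?X ?Y \<or> card ?X = 1 \<and> card ?Y = k - 1 \<and> nearly_good G ?X ?Y"
    using assms unfolding nearly_robust_def by simp
  moreover have "good G X Y" if "good G ?X ?Y"
    using that by (rule good_cong) auto
  moreover have "good G (insert a X) Y" if "good G (insert a ?X) ?Y" for a
    using that by (rule good_cong) auto
  ultimately show ?thesis unfolding nearly_good_def by blast
qed


section \<open>Joining two graphs\<close>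

locale joined =
  fixes G0 G1 :: "'a ugraph" and \<phi> :: "'a \<Rightarrow> 'a"
  assumes wf0: "wf_graph G0" and wf1: "wf_graph G1"
    and disj: "verts G0 \<inter> verts G1 = {}"
    and bij: "bij_betw \<phi> (verts G0) (verts G1)"
begin

abbreviation "H \<equiv> oplus_graph \<phi> G0 G1"

section \<open>Vertices, edges and symmetry of the join\<close>

lemma verts_H: "verts H = verts G0 \<union> verts G1"
  by (simp add: oplus_graph_def)

lemma edges_H: "edges H = edges G0 \<union> edges G1 \<union> {{v, \<phi> v} | v. v \<in> verts G0}"
  by (simp add: oplus_graph_def)

lemma phi_in: "v \<in> verts G0 \<Longrightarrow> \<phi> v \<in> verts G1"
  using bij by (auto simp: bij_betw_def)

lemma phi_inj: "\<lbrakk>u \<in> verts G0; v \<in> verts G0\<rbrakk> \<Longrightarrow> \<phi> u = \<phi> v \<longleftrightarrow> u = v"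
  using bij by (auto simp: bij_betw_def inj_on_def)

lemma finite_verts_H: "finite (verts H)"
  using wf0 wf1 by (simp add: verts_H wf_graph_def)

lemma edges_disjoint: "edges G0 \<inter> edges G1 = {}"
proof (rule equals0I)
  fix e assume e: "e \<in> edges G0 \<inter> edges G1"
  then obtain u v where uv: "u \<in> verts G0" "e = {u, v}" using wf0 by (auto simp: wf_graph_def)
  then have "u \<in> verts G1" using e wf_graph_edgeD(1)[OF wf1, of u v] by simp
  then show False using uv disj by blast
qed

lemma cross_edge:
  assumes "v \<in> verts G0"
  shows "{v, \<phi> v} \<in> edges H" "{v, \<phi> v} \<notin> edges G0" "{v, \<phi> v} \<notin> edges G1"
  using assms phi_in[OF assms] disj wf_graph_edgeD[OF wf0, of v "\<phi> v"] wf_graph_edgeD[OF wf1, of v "\<phi> v"]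
  by (auto simp: edges_H)

lemma wf_H: "wf_graph H"
  unfolding wf_graph_def
proof (intro conjI ballI)
  fix e assume "e \<in> edges H"
  then consider "e \<in> edges G0" | "e \<in> edges G1" | v where "v \<in> verts G0" "e = {v, \<phi> v}"
    by (auto simp: edges_H)
  then show "\<exists>u\<in>verts H. \<exists>v\<in>verts H. u \<noteq> v \<and> e = {u, v}"
  proof cases
    case 1
    then show ?thesis using wf0 by (fastforce simp: wf_graph_def verts_H)
  next
    case 2
    then show ?thesis using wf1 by (fastforce simp: wf_graph_def verts_H)
  next
    case 3
    then show ?thesis using phi_in[of v] disj by (intro bexI[of _ v] bexI[of _ "\<phi> v"]) (auto simp: verts_H)
  qed
qed (rule finite_verts_H)

text \<open>The inverse bijection gives the same join with the halves exchanged, so later arguments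
  may call the bad half \<open>G0\<close>.\<close>

lemma flip: "joined G1 G0 (inv_into (verts G0) \<phi>)"
  using wf0 wf1 disj bij by unfold_locales (auto intro: bij_betw_inv_into)

lemma flip_graph: "oplus_graph (inv_into (verts G0) \<phi>) G1 G0 = H"
proof -
  let ?\<psi> = "inv_into (verts G0) \<phi>"
  have "{{v, ?\<psi> v} | v. v \<in> verts G1} = (\<lambda>v. {v, ?\<psi> v}) ` (\<phi> ` verts G0)"
    using bij by (auto simp: bij_betw_def)
  also have "\<dots> = (\<lambda>v. {v, \<phi> v}) ` verts G0"
    unfolding image_image
    using bij by (intro image_cong) (auto simp: bij_betw_def inv_into_f_f insert_commute)
  finally show ?thesis by (auto simp: oplus_graph_def)
qed

lemma card_split_verts:
  assumes "X \<subseteq> verts H"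
  shows "card X = card (X \<inter> verts G0) + card (X \<inter> verts G1)"
proof -
  have "X = (X \<inter> verts G0) \<union> (X \<inter> verts G1)" using assms by (auto simp: verts_H)
  moreover have "card ((X \<inter> verts G0) \<union> (X \<inter> verts G1)) = card (X \<inter> verts G0) + card (X \<inter> verts G1)"
    using wf0 wf1 disj by (intro card_Un_disjoint) (auto simp: wf_graph_def)
  ultimately show ?thesis by simp
qed

lemma card_split_edges:
  assumes "Y \<subseteq> edges H"
  shows "card Y = card (Y \<inter> edges G0) + card (Y \<inter> edges G1) + card (Y - edges G0 - edges G1)"
proof -
  have fin: "finite Y" using assms wf_graph_finite_edges[OF wf_H] finite_subset by blast
  have "card Y = card (Y \<inter> edges G0) + card (Y - edges G0)"
    using fin by (metis card_Int_Diff)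
  also have "card (Y - edges G0) = card ((Y - edges G0) \<inter> edges G1) + card (Y - edges G0 - edges G1)"
    using fin by (intro card_Int_Diff) simp
  also have "(Y - edges G0) \<inter> edges G1 = Y \<inter> edges G1" using edges_disjoint by blast
  finally show ?thesis by simp
qed

text \<open>The share of the work that leaves \<open>G0\<close>: the vertices in \<open>S\<close>
  are served across, together with all healthy vertices of \<open>G1\<close>. Phrasing it as a
  demand on the whole join allows convex combinations over different \<open>S\<close>.\<close>

definition sends :: "'a set \<Rightarrow> 'a set set \<Rightarrow> 'a set \<Rightarrow> bool" where
  "sends X Y S \<longleftrightarrow> realizable (verts H) (edges H - Y)
     (\<lambda>v. if v \<in> verts G0 then of_bool (v \<in> S) else of_bool (v \<notin> X))"

lemma sendsI:
  assumes S: "S \<subseteq> verts G0" and X: "\<phi> ` S \<inter> X = {}" and Y: "\<And>v. v \<in> S \<Longrightarrow> {v, \<phi> v} \<notin> Y"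
    and good: "good G1 (\<phi> ` S \<union> X) Y"
  shows "sends X Y S"
proof -
  let ?D = "edges H - Y"
  have finS: "finite S" using S wf0 finite_subset by (auto simp: wf_graph_def)
  have "realizable (verts G1) ?D (\<lambda>v. of_bool (v \<notin> \<phi> ` S \<union> X))"
    using good unfolding good_def by (rule realizable_mono) (auto simp: edges_H)
  then have 1: "realizable (verts H) ?D (\<lambda>v. if v \<in> verts G1 then of_bool (v \<notin> \<phi> ` S \<union> X) else 0)"
    by (rule realizable_extend) (use finite_verts_H in \<open>auto simp: verts_H\<close>)
  have 2: "realizable (verts H) ?D (\<lambda>x. \<Sum>v\<in>S. if x = v \<or> x = \<phi> v then 1 else 0)"
  proof (rule realizable_sum, rule realizable_edge)
    fix v assume "v \<in> S"
    then have "v \<in> verts G0" using S by blast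
    with \<open>v \<in> S\<close> show "v \<in> verts H" "\<phi> v \<in> verts H" "v \<noteq> \<phi> v" "{v, \<phi> v} \<in> ?D"
      using phi_in[of v] disj cross_edge(1)[of v] Y[of v] by (auto simp: verts_H)
  qed (use finite_verts_H in auto)
  \<comment> \<open>Every vertex of the join lies on exactly one cross edge, so the chosen cross
    edges contribute 1 at their endpoints and 0 elsewhere.\<close>
  have eq: "(\<Sum>v\<in>S. if x = v \<or> x = \<phi> v then 1 else (0::real)) = of_bool (x \<in> S \<or> x \<in> \<phi> ` S)"
    if "x \<in> verts H" for x
  proof (cases "x \<in> verts G0")
    case True
    then have "x \<noteq> \<phi> v" if "v \<in> S" for v using that S phi_in disj by blast
    then show ?thesis using finS by (auto simp: image_iff sum.delta cong: sum.cong)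
  next
    case False
    then have ne: "x \<noteq> v" if "v \<in> S" for v using that S by blast
    show ?thesis
    proof (cases "x \<in> \<phi> ` S")
      case True
      then obtain y where y: "y \<in> S" "x = \<phi> y" by blast
      have "(\<Sum>v\<in>S. if x = v \<or> x = \<phi> v then 1 else (0::real)) = (\<Sum>v\<in>S. if v = y then 1 else 0)"
        using ne y subsetD[OF S] phi_inj by (intro sum.cong) auto
      then show ?thesis using y finS by auto
    next
      case False
      then have "(\<Sum>v\<in>S. if x = v \<or> x = \<phi> v then 1 else (0::real)) = 0"
        using ne by (intro sum.neutral) auto
      then show ?thesis using False ne by auto
    qed
  qed
  show ?thesis unfolding sends_def
  proof (rule realizable_cong[OF realizable_add[OF 1 2]])
    fix v assume v: "v \<in> verts H"
    show "(if v \<in> verts G1 then of_bool (v \<notin> \<phi> ` S \<union> X) else 0) + (\<Sum>y\<in>S. if v = y \<or> v = \<phi> y then 1 else 0) =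
      (if v \<in> verts G0 then of_bool (v \<in> S) else (of_bool (v \<notin> X)::real))"
      unfolding eq[OF v] using v S X disj phi_in by (auto simp: verts_H)
  qed
qed

text \<open>Here \<open>b\<close> is what \<open>G0\<close> supplies with its own edges; the second
  hypothesis covers the deficit in \<open>G0\<close> and all of \<open>G1\<close>.\<close>

lemma good_join:
  assumes "realizable (verts G0) (edges G0 - Y) b"
    and "realizable (verts H) (edges H - Y)
      (\<lambda>v. if v \<in> verts G0 then of_bool (v \<notin> X) - b v else of_bool (v \<notin> X))"
  shows "good H X Y"
proof -
  have "realizable (verts G0) (edges H - Y) b"
    using assms(1) by (rule realizable_mono) (auto simp: edges_H)
  then have "realizable (verts H) (edges H - Y) (\<lambda>v. if v \<in> verts G0 then b v else 0)"
    by (rule realizable_extend) (use finite_verts_H in \<open>auto simp: verts_H\<close>)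
  from realizable_add[OF this assms(2)] show ?thesis
    unfolding good_def by (rule realizable_cong) auto
qed

lemma good_send:
  assumes "S \<inter> X = {}" "sends X Y S" "good G0 (S \<union> X) Y"
  shows "good H X Y"
proof (rule good_join)
  show "realizable (verts G0) (edges G0 - Y) (\<lambda>v. of_bool (v \<notin> S \<union> X))"
    using assms(3) by (simp add: good_def)
  show "realizable (verts H) (edges H - Y)
      (\<lambda>v. if v \<in> verts G0 then of_bool (v \<notin> X) - of_bool (v \<notin> S \<union> X) else of_bool (v \<notin> X))"
    using assms(2) unfolding sends_def by (rule realizable_cong) (use assms(1) in auto)
qed

lemma good_both:
  assumes "good G0 X Y" "good G1 X Y"
  shows "good H X Y"
  using assms by (intro good_send[of "{}"] sendsI) auto

text \<open>In a solution that still contains \<open>x\<close>, the weight that \<open>x\<close> gave to a neighbour \<open>y\<close> is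
  rerouted through the cross edge at \<open>y\<close>. These weights sum to 1, so the second half sees a
  convex combination of demands, each missing one vertex.\<close>

lemma good_restore_vertex:
  assumes x: "x \<in> verts G0" "x \<in> X" and good: "good G0 (X - {x}) Y"
    and sends: "\<And>y. y \<in> verts G0 - X \<Longrightarrow> sends X Y {y}"
  shows "good H X Y"
proof -
  let ?V = "verts G0"
  have fin: "finite ?V" using wf0 by (simp add: wf_graph_def)
  obtain w :: "'a \<Rightarrow> 'a \<Rightarrow> real" where w0: "\<And>u v. 0 \<le> w u v" and wsym: "\<And>u v. w u v = w v u"
    and wE: "\<And>u v. w u v \<noteq> 0 \<Longrightarrow> {u, v} \<in> edges G0 - Y"
    and wsum: "\<And>u. u \<in> ?V \<Longrightarrow> (\<Sum>v\<in>?V. w u v) = of_bool (u \<notin> X - {x})"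
    using good unfolding good_def by (rule realizableE) blast
  \<comment> \<open>The restored vertex \<open>x\<close> gives nothing to itself or to other faulty
    vertices, so its whole unit goes to healthy ones.\<close>
  have zero: "w x u = 0" if "u \<in> ?V" "u \<in> X" for u
  proof (cases "u = x")
    case True
    then show ?thesis using wE[of x x] wf_graph_edgeD(3)[OF wf0, of x x] by auto
  next
    case False
    then have "(\<Sum>v\<in>?V. w u v) = 0" using wsum[OF that(1)] that(2) by simp
    then have "w u x = 0" using sum_nonneg_eq_0_iff[OF fin, of "w u"] w0 x(1) by simp
    then show ?thesis using wsym[of x u] by simp
  qed
  have total: "(\<Sum>y\<in>?V - X. w x y) = 1"
  proof -
    have "(\<Sum>y\<in>?V - X. w x y) = (\<Sum>y\<in>?V. w x y)"
      using fin zero by (intro sum.mono_neutral_left) auto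
    then show ?thesis using wsum[OF x(1)] by simp
  qed
  show ?thesis
  proof (rule good_join)
    \<comment> \<open>Erasing the row and column of \<open>x\<close> leaves a deficit of
      \<open>w x u\<close> at each healthy \<open>u\<close>.\<close>
    show "realizable ?V (edges G0 - Y) (\<lambda>u. if u = x then 0 else of_bool (u \<notin> X) - w x u)"
    proof (rule realizableI[of "\<lambda>u v. if u = x \<or> v = x then 0 else w u v"])
      fix u assume u: "u \<in> ?V"
      have "(\<Sum>v\<in>?V. w u v) = w u x + (\<Sum>v\<in>?V - {x}. w u v)"
        using fin x(1) by (rule sum.remove)
      moreover have "(\<Sum>v\<in>?V. if u = x \<or> v = x then 0 else w u v) = (\<Sum>v\<in>?V - {x}. w u v)" if "u \<noteq> x"
        using fin that by (intro sum.mono_neutral_cong_right) auto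
      ultimately show "(\<Sum>v\<in>?V. if u = x \<or> v = x then 0 else w u v) =
          (if u = x then 0 else of_bool (u \<notin> X) - w x u)"
        using wsum[OF u] wsym[of u x] by auto
    next
      show "(if u = x \<or> v = x then 0 else w u v) = (if v = x \<or> u = x then 0 else w v u)" for u v
        using wsym[of u v] by simp
    qed (use w0 wE in \<open>auto split: if_splits\<close>)
    have "realizable (verts H) (edges H - Y)
      (\<lambda>v. \<Sum>y\<in>?V - X. w x y * (if v \<in> ?V then of_bool (v \<in> {y}) else of_bool (v \<notin> X)))"
      using sends w0 unfolding sends_def by (intro realizable_sum realizable_scale) auto
    then show "realizable (verts H) (edges H - Y)
      (\<lambda>v. if v \<in> ?V then of_bool (v \<notin> X) - (if v = x then 0 else of_bool (v \<notin> X) - w x v)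
           else of_bool (v \<notin> X))"
    proof (rule realizable_cong)
      fix v assume "v \<in> verts H"
      show "(\<Sum>y\<in>?V - X. w x y * (if v \<in> ?V then of_bool (v \<in> {y}) else of_bool (v \<notin> X))) =
        (if v \<in> ?V then of_bool (v \<notin> X) - (if v = x then 0 else of_bool (v \<notin> X) - w x v)
           else of_bool (v \<notin> X))"
      proof (cases "v \<in> ?V")
        case True
        have "(\<Sum>y\<in>?V - X. w x y * of_bool (v \<in> {y})) = (\<Sum>y\<in>?V - X. if y = v then w x y else 0)"
          by (intro sum.cong) auto
        also have "\<dots> = (if v \<in> X then 0 else w x v)" using fin True by (simp add: sum.delta)
        finally show ?thesis using True zero[of v] x by auto
      next
        case False
        then show ?thesis using total by (simp flip: sum_distrib_right)
      qed
    qed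
  qed
qed

text \<open>If the forgotten edge carries weight \<open>t\<close>, dropping it leaves a deficit
  \<open>t\<close> at both ends. The second half meets it by mixing \<open>sends X Y {}\<close> with
  weight \<open>1 - t\<close> and \<open>sends X Y {u, v}\<close> with weight \<open>t\<close>. A
  faulty end forces \<open>t = 0\<close>, hence the conditional hypothesis.\<close>

lemma good_restore_edge:
  assumes uv: "{u, v} \<in> edges G0" and good: "good G0 X (Y - {{u, v}})"
    and sends0: "sends X Y {}" and sends: "\<lbrakk>u \<notin> X; v \<notin> X\<rbrakk> \<Longrightarrow> sends X Y {u, v}"
  shows "good H X Y"
proof -
  let ?V = "verts G0"
  have fin: "finite ?V" using wf0 by (simp add: wf_graph_def)
  note uvV = wf_graph_edgeD[OF wf0 uv]
  obtain w :: "'a \<Rightarrow> 'a \<Rightarrow> real" where w0: "\<And>u v. 0 \<le> w u v" and wsym: "\<And>u v. w u v = w v u"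
    and wE: "\<And>a b. w a b \<noteq> 0 \<Longrightarrow> {a, b} \<in> edges G0 - (Y - {{u, v}})"
    and wsum: "\<And>u. u \<in> ?V \<Longrightarrow> (\<Sum>v\<in>?V. w u v) = of_bool (u \<notin> X)"
    using good unfolding good_def by (rule realizableE) blast
  define t where "t = w u v"
  have le: "w a b \<le> of_bool (a \<notin> X)" if "a \<in> ?V" "b \<in> ?V" for a b
    using member_le_sum[of b ?V "w a"] wsum[OF that(1)] that fin w0 by auto
  have t1: "t \<le> 1"
    using le[of u v] uvV by (cases "u \<in> X") (auto simp: t_def)
  have t: "0 \<le> t" "t \<le> of_bool (u \<notin> X)" "t \<le> of_bool (v \<notin> X)"
    using w0[of u v] le[of u v] le[of v u] wsym[of u v] uvV by (auto simp: t_def)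
  show ?thesis
  proof (rule good_join)
    show "realizable ?V (edges G0 - Y) (\<lambda>a. of_bool (a \<notin> X) - (if a = u \<or> a = v then t else 0))"
    proof (rule realizableI[of "\<lambda>a b. if {a, b} = {u, v} then 0 else w a b"])
      fix a assume a: "a \<in> ?V"
      have "(\<Sum>b\<in>?V. if {a, b} = {u, v} then 0 else w a b) =
            (\<Sum>b\<in>?V. w a b - (if a = u \<and> b = v \<or> a = v \<and> b = u then t else 0))"
        by (intro sum.cong) (auto simp: t_def doubleton_eq_iff wsym)
      also have "\<dots> = of_bool (a \<notin> X) - (\<Sum>b\<in>?V. if a = u \<and> b = v \<or> a = v \<and> b = u then t else 0)"
        using wsum[OF a] by (simp add: sum_subtractf)
      also have "(\<Sum>b\<in>?V. if a = u \<and> b = v \<or> a = v \<and> b = u then t else 0) = (if a = u \<or> a = v then t else 0)"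
        using uvV fin by (cases "a = u"; cases "a = v") auto
      finally show "(\<Sum>b\<in>?V. if {a, b} = {u, v} then 0 else w a b) =
        of_bool (a \<notin> X) - (if a = u \<or> a = v then t else 0)" .
    next
      show "(if {a, b} = {u, v} then 0 else w a b) = (if {b, a} = {u, v} then 0 else w b a)" for a b
        using wsym[of a b] by (simp add: insert_commute)
    next
      show "{a, b} \<in> edges G0 - Y" if "(if {a, b} = {u, v} then 0 else w a b) \<noteq> 0" for a b
        using that wE[of a b] by (simp split: if_splits)
    qed (use w0 in auto)
    have 1: "realizable (verts H) (edges H - Y)
      (\<lambda>a. (1 - t) * (if a \<in> ?V then of_bool (a \<in> {}) else of_bool (a \<notin> X)))"
      using sends0 t1 unfolding sends_def by (intro realizable_scale) auto
    have 2: "realizable (verts H) (edges H - Y)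
      (\<lambda>a. t * (if a \<in> ?V then of_bool (a \<in> {u, v}) else of_bool (a \<notin> X)))"
    proof (cases "u \<in> X \<or> v \<in> X")
      case True
      then have "t = 0" using t by auto
      then show ?thesis by (simp add: realizable_zero)
    next
      case False
      then show ?thesis using sends t(1) unfolding sends_def by (intro realizable_scale) auto
    qed
    show "realizable (verts H) (edges H - Y)
      (\<lambda>a. if a \<in> ?V then of_bool (a \<notin> X) - (of_bool (a \<notin> X) - (if a = u \<or> a = v then t else 0))
           else of_bool (a \<notin> X))"
      by (rule realizable_cong[OF realizable_add[OF 1 2]]) (auto simp: algebra_simps)
  qed
qed


text \<open>With at most \<open>k\<close> faults in \<open>G0\<close> a repair vertex is matched
  across; with all \<open>Suc k\<close> faults there, one of them is forgotten and restored. The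
  exception survives only for \<open>k = 2\<close>, when the single fault outside \<open>G0\<close>
  is an edge of \<open>G1\<close>.\<close>

lemma good_one_side:
  assumes k: "2 \<le> k" and nr0: "nearly_robust G0 k" and nr1: "nearly_robust G1 k"
    and X: "X \<subseteq> verts H" and Y: "Y \<subseteq> edges H" and card: "card X + card Y \<le> Suc k"
    and bad: "\<not> good G0 X Y"
  shows "good H X Y \<or> k = 2 \<and> card X = 1 \<and> card Y = k \<and> nearly_good H X Y"
proof -
  let ?X0 = "X \<inter> verts G0" and ?X1 = "X \<inter> verts G1"
  let ?Y0 = "Y \<inter> edges G0" and ?Y1 = "Y \<inter> edges G1" and ?Yc = "Y - edges G0 - edges G1"
  have finX: "finite X" using X finite_verts_H finite_subset by blast
  have finY: "finite Y" using Y wf_graph_finite_edges[OF wf_H] finite_subset by blast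
  have total: "card ?X0 + card ?X1 + (card ?Y0 + card ?Y1 + card ?Yc) \<le> Suc k"
    using card card_split_verts[OF X] card_split_edges[OF Y] by simp
  \<comment> \<open>The exceptional shape contains \<open>k - 1 \<ge> 1\<close> faulty edges, so two
    vertex faults alone never produce it.\<close>
  have good1: "good G1 Z Y" if "card (Z \<inter> verts G1) \<le> 2" "?Y1 = {}" for Z
    using nearly_robustD[OF nr1 wf1, of Z Y] that k by auto
  show ?thesis
  proof (cases "card ?X0 + card ?Y0 \<le> k")
    case True
    \<comment> \<open>A bad \<open>G0\<close> now has the exceptional shape, which uses up
      \<open>k\<close> faults and leaves at most one elsewhere.\<close>
    with nearly_robustD[OF nr0 wf0] bad
    have X01: "card ?X0 = 1" and Y0k: "card ?Y0 = k - 1" and "nearly_good G0 X Y" by auto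
    then obtain a b where ab: "a \<in> verts G0 - X" "b \<in> verts G0 - X" "a \<noteq> b"
      and good_ab: "good G0 (insert a X) Y" "good G0 (insert b X) Y"
      unfolding nearly_good_def by blast
    have rest: "card ?X1 + card ?Y1 + card ?Yc \<le> 1" using total X01 Y0k k by simp
    have send: "good H X Y"
      if c: "c \<in> verts G0 - X" "good G0 (insert c X) Y" "\<phi> c \<notin> X" "{c, \<phi> c} \<notin> Y"
        and g: "good G1 (insert (\<phi> c) X) Y" for c
      using c g by (intro good_send[of "{c}"] sendsI) auto
    show ?thesis
    proof (cases "card ?Y1 = 0")
      case True
      with rest have other: "card ?X1 + card ?Yc \<le> 1" "card ?Y1 = 0" by auto
      have Y1: "?Y1 = {}" using other(2) finY by simp
      \<comment> \<open>The one remaining fault is a vertex of \<open>G1\<close> or a cross edge,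
        and it can obstruct the crossing at only one of \<open>a\<close> and
        \<open>b\<close>.\<close>
      obtain c where c: "c \<in> {a, b}" "\<phi> c \<notin> X" "{c, \<phi> c} \<notin> Y"
      proof (cases "\<phi> a \<notin> X \<and> {a, \<phi> a} \<notin> Y")
        case False
        have phi_ne: "\<phi> a \<noteq> \<phi> b" using ab phi_inj by auto
        have edge_ne: "{a, \<phi> a} \<noteq> {b, \<phi> b}"
          using ab phi_in[of a] phi_in[of b] disj by (auto simp: doubleton_eq_iff)
        have ca: "{a, \<phi> a} \<in> ?Yc" if "{a, \<phi> a} \<in> Y" using that cross_edge ab by auto
        have cb: "{b, \<phi> b} \<in> ?Yc" if "{b, \<phi> b} \<in> Y" using that cross_edge ab by auto
        have one1: "x = y" if "x \<in> ?X1" "y \<in> ?X1" for x y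
          using that other(1) card_le_Suc0_iff_eq[of ?X1] finX by auto
        have onec: "x = y" if "x \<in> ?Yc" "y \<in> ?Yc" for x y
          using that other(1) card_le_Suc0_iff_eq[of ?Yc] finY by auto
        have no: False if "x \<in> ?X1" "y \<in> ?Yc" for x y
        proof -
          have "0 < card ?X1" "0 < card ?Yc" using that finX finY by (auto simp: card_gt_0_iff)
          then show False using other(1) by simp
        qed
        have "\<phi> a \<in> verts G1" "\<phi> b \<in> verts G1" using ab phi_in by auto
        then have "\<phi> b \<notin> X \<and> {b, \<phi> b} \<notin> Y"
          using False phi_ne edge_ne ca cb one1[of "\<phi> a" "\<phi> b"] onec[of "{a, \<phi> a}" "{b, \<phi> b}"]
            no[of "\<phi> a" "{b, \<phi> b}"] no[of "\<phi> b" "{a, \<phi> a}"] by blast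
        then show ?thesis using that by blast
      qed (use that in blast)
      have "insert (\<phi> c) X \<inter> verts G1 \<subseteq> insert (\<phi> c) ?X1" by blast
      then have "card (insert (\<phi> c) X \<inter> verts G1) \<le> card (insert (\<phi> c) ?X1)"
        using finX by (intro card_mono) auto
      also have "\<dots> \<le> 2" using other(1) finX by (simp add: card_insert_if)
      finally have "good G1 (insert (\<phi> c) X) Y" using Y1 by (rule good1)
      then show ?thesis using send[of c] c ab good_ab by blast
    next
      case False
      with rest have edge: "card ?X1 = 0" "card ?Yc = 0" "card ?Y1 = 1" by auto
      then have X1: "?X1 = {}" and Yc: "?Yc = {}" using finX finY by auto
      have X1': "insert (\<phi> a) X \<inter> verts G1 = {\<phi> a}" using X1 ab phi_in by auto
      show ?thesis
      \<comment> \<open>Sending \<open>a\<close> across would give \<open>G1\<close> one vertex and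
        one edge, which for \<open>k = 2\<close> is the exceptional shape again. In that case
        \<open>G1\<close> is good without the extra vertex, so \<open>a\<close> and \<open>b\<close>
        serve as repairs for the whole join.\<close>
      proof (cases "k = 2")
        case True
        have g1: "good G1 X Y" using nearly_robustD[OF nr1 wf1, of X Y] X1 edge(3) k by auto
        have "good G1 (insert c X) Y" if "c \<in> verts G0" for c
          using g1 by (rule good_cong) (use that disj in auto)
        then have "good H (insert a X) Y" "good H (insert b X) Y"
          using good_ab ab by (auto intro: good_both)
        then have "nearly_good H X Y"
          unfolding nearly_good_def using ab by (auto simp: verts_H)
        moreover have "card X = 1" using card_split_verts[OF X] X01 edge by simp
        moreover have "card Y = k" using card_split_edges[OF Y] Y0k edge k by simp
        ultimately show ?thesis using True by blast
      next
        case False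
        \<comment> \<open>For \<open>k \<ge> 3\<close>, these two faults are fewer than the
          \<open>k\<close> faults of the exceptional shape.\<close>
        then have "good G1 (insert (\<phi> a) X) Y"
          using nearly_robustD[OF nr1 wf1, of "insert (\<phi> a) X" Y] X1' edge(3) k by auto
        moreover have "\<phi> a \<notin> X" using X1 ab phi_in by auto
        moreover have "{a, \<phi> a} \<notin> Y" using Yc ab cross_edge(2,3)[of a] by auto
        ultimately show ?thesis using send ab(1) good_ab(1) by blast
      qed
    qed
  next
    case False
    then have all: "card ?X0 + card ?Y0 = Suc k" and "card ?X1 = 0" "card ?Y1 = 0" "card ?Yc = 0"
      using total by auto
    then have X1: "?X1 = {}" and Y1: "?Y1 = {}" and Yc: "?Yc = {}" using finX finY by auto
    \<comment> \<open>\<open>G1\<close> and the cross edges are free of faults, so \<open>G1\<close>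
      misses only the at most two partners of \<open>S\<close>.\<close>
    have sends: "sends X Y S" if S: "S \<subseteq> verts G0" "card S \<le> 2" for S
    proof (rule sendsI[OF S(1)])
      show "\<phi> ` S \<inter> X = {}" using X1 S phi_in by blast
      show "{v, \<phi> v} \<notin> Y" if "v \<in> S" for v using that S Yc cross_edge(2,3)[of v] by blast
      have "(\<phi> ` S \<union> X) \<inter> verts G1 = \<phi> ` S" using X1 S phi_in by blast
      moreover have "finite S" using S wf0 finite_subset by (auto simp: wf_graph_def)
      ultimately show "good G1 (\<phi> ` S \<union> X) Y"
        using S(2) card_image_le[of S \<phi>] Y1 by (intro good1) auto
    qed
    show ?thesis
    \<comment> \<open>The fault to forget is chosen so that the number of faulty vertices left in
      \<open>G0\<close> is not 1. An edge does this if that number already differs from 1; otherwise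
      forgetting a vertex leaves 0 or \<open>k\<close> faulty vertices.\<close>
    proof (cases "card ?X0 \<noteq> 1 \<and> ?Y0 \<noteq> {}")
      case True
      then obtain e where e: "e \<in> ?Y0" by blast
      then obtain u v where uv: "u \<in> verts G0" "v \<in> verts G0" "e = {u, v}"
        using wf0 by (auto simp: wf_graph_def)
      have "(Y - {e}) \<inter> edges G0 = ?Y0 - {e}" by blast
      then have "card ((Y - {e}) \<inter> edges G0) = card ?Y0 - 1" using e finY by simp
      moreover have "0 < card ?Y0" using True finY by (simp add: card_gt_0_iff)
      ultimately have "good G0 X (Y - {e})"
        using nearly_robustD[OF nr0 wf0, of X "Y - {e}"] all True by auto
      then have "good H X Y"
        using e uv by (intro good_restore_edge[of u v] sends) (auto simp: card_insert_if)
      then show ?thesis by blast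
    next
      case False
      then have "?X0 \<noteq> {}" using all by auto
      then obtain x where x: "x \<in> ?X0" by blast
      have "(X - {x}) \<inter> verts G0 = ?X0 - {x}" by blast
      then have cx: "card ((X - {x}) \<inter> verts G0) = card ?X0 - 1" using x finX by simp
      have "card ?X0 = 1 \<or> card ?X0 = Suc k" using False all by auto
      then have "good G0 (X - {x}) Y"
        using nearly_robustD[OF nr0 wf0, of "X - {x}" Y] all cx k by auto
      then have "good H X Y"
        using x by (intro good_restore_vertex[of x] sends) auto
      then show ?thesis by blast
    qed
  qed
qed

lemma good_or_nearly_good:
  assumes k: "2 \<le> k" and nr: "nearly_robust G0 k" "nearly_robust G1 k"
    and XY: "X \<subseteq> verts H" "Y \<subseteq> edges H" "card X + card Y \<le> Suc k"
  shows "good H X Y \<or> k = 2 \<and> card X = 1 \<and> card Y = k \<and> nearly_good H X Y"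
proof (cases "good G0 X Y")
  case False
  then show ?thesis using good_one_side[OF assms] by blast
next
  case True
  show ?thesis
  proof (cases "good G1 X Y")
    case True
    with \<open>good G0 X Y\<close> show ?thesis using good_both by blast
  next
    case False
    then show ?thesis
      using joined.good_one_side[OF flip k nr(2,1), unfolded flip_graph, OF XY] by blast
  qed
qed

lemma nearly_robust_join:
  assumes "2 \<le> k" "nearly_robust G0 k" "nearly_robust G1 k"
  shows "nearly_robust H (Suc k)"
  using good_or_nearly_good[OF assms] unfolding nearly_robust_def by auto

text \<open>The surviving exception belongs to \<open>k = 2\<close>, that is, to halves of dimension
  3; halves of dimension 4 or more leave none.\<close>

lemma robust_join:
  assumes "3 \<le> k" "nearly_robust G0 k" "nearly_robust G1 k"
  shows "robust H (Suc k)"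
  using good_or_nearly_good[OF _ assms(2,3)] assms(1) unfolding robust_def by auto

text \<open>An upper bound on degrees suffices, since the lower bound on FSMP sets later gives
  equality. Vertices of \<open>G1\<close> are covered by \<open>flip\<close>.\<close>

lemma degree_join:
  assumes d0: "\<And>v. v \<in> verts G0 \<Longrightarrow> card {e \<in> edges G0. v \<in> e} \<le> d" and v: "v \<in> verts G0"
  shows "card {e \<in> edges H. v \<in> e} \<le> Suc d"
proof -
  have "{e \<in> edges H. v \<in> e} \<subseteq> insert {v, \<phi> v} {e \<in> edges G0. v \<in> e}"
  proof
    fix e assume "e \<in> {e \<in> edges H. v \<in> e}"
    moreover have "v \<notin> e" if "e \<in> edges G1"
      using that wf1 v disj by (auto simp: wf_graph_def)
    ultimately show "e \<in> insert {v, \<phi> v} {e \<in> edges G0. v \<in> e}"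
      using v disj phi_in by (auto simp: edges_H)
  qed
  moreover have fin: "finite {e \<in> edges G0. v \<in> e}" using wf_graph_finite_edges[OF wf0] by simp
  ultimately have "card {e \<in> edges H. v \<in> e} \<le> card (insert {v, \<phi> v} {e \<in> edges G0. v \<in> e})"
    by (intro card_mono) auto
  also have "\<dots> \<le> Suc d" using d0[OF v] fin by (simp add: card_insert_if)
  finally show ?thesis .
qed

end


section \<open>The graph G(8,4)\<close>

text \<open>This graph is the Wagner graph: an 8-cycle with its four long chords. Rim edges and
  chords are separate images over all indices, each chord arising twice.\<close>

definition labelling :: "'a ugraph \<Rightarrow> (nat \<Rightarrow> 'a) \<Rightarrow> bool" where
  "labelling G f \<longleftrightarrow> bij_betw f {..<8} (verts G) \<and>
     edges G = (\<lambda>i. {f i, f ((i + 1) mod 8)}) ` {..<8} \<union> (\<lambda>i. {f i, f ((i + 4) mod 8)}) ` {..<8}"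

lemma edges_G84:
  "edges G84 = (\<lambda>i. {i, (i + 1) mod 8}) ` {..<8} \<union> (\<lambda>i. {i, (i + 4) mod 8}) ` {..<8}"
proof -
  have "j < 8 \<Longrightarrow> [j = i + c] (mod 8) \<longleftrightarrow> j = (i + c) mod 8" for i j c :: nat
    by (auto simp: cong_def)
  then have "edges G84 = {{i, j} | i j. i < 8 \<and> j < 8 \<and> (j = (i + 1) mod 8 \<or> j = (i + 4) mod 8)}"
    unfolding G84_def by (simp del: One_nat_def) blast
  also have "\<dots> = (\<lambda>i. {i, (i + 1) mod 8}) ` {..<8} \<union> (\<lambda>i. {i, (i + 4) mod 8}) ` {..<8}"
    by (fastforce simp: image_iff)
  finally show ?thesis .
qed

lemma rotation_bij: "bij_betw (\<lambda>i. (i + k) mod 8) {..<8} {..<8::nat}"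
proof -
  have "inj_on (\<lambda>i. (i + k) mod 8) {..<8::nat}"
  proof (rule inj_onI)
    fix i j :: nat assume ij: "i \<in> {..<8}" "j \<in> {..<8}" "(i + k) mod 8 = (j + k) mod 8"
    then have "[i + k = j + k] (mod 8)" by (simp add: cong_def)
    then have "[i = j] (mod 8)" by (simp only: cong_add_rcancel_nat)
    then show "i = j" using ij by (simp add: cong_def)
  qed
  moreover have "(\<lambda>i. (i + k) mod 8) ` {..<8} \<subseteq> {..<8::nat}" by auto
  ultimately show ?thesis
    unfolding bij_betw_def using endo_inj_surj[of "{..<8::nat}"] by blast
qed

text \<open>Rotations act transitively on the vertices, so a faulty vertex may always be given the
  label 0.\<close>

lemma labelling_at:
  assumes "isomorphic G84 G" "v \<in> verts G"
  obtains f where "labelling G f" "f 0 = v"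
proof -
  obtain g where g: "bij_betw g {..<8} (verts G)" and E: "edges G = (\<lambda>e. g ` e) ` edges G84"
    using assms(1) by (auto simp: isomorphic_def G84_def atLeast0LessThan)
  have "v \<in> g ` {..<8}" using assms(2) bij_betw_imp_surj_on[OF g] by simp
  then obtain k where k: "k < 8" "g k = v" by auto
  define r where "r i = (i + k) mod 8" for i
  have r: "r ` {..<8} = {..<8}" "bij_betw r {..<8} {..<8}"
    using rotation_bij[of k] by (simp_all add: bij_betw_def r_def[abs_def])
  have step: "(r i + c) mod 8 = r ((i + c) mod 8)" for i c
    by (simp add: r_def mod_simps ac_simps)
  \<comment> \<open>Reindexing by the bijection \<open>r\<close> permutes the rim edges among
    themselves, and likewise the chords.\<close>
  have shift: "(\<lambda>i. {g i, g ((i + c) mod 8)}) ` {..<8} =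
      (\<lambda>i. {g (r i), g (r ((i + c) mod 8))}) ` {..<8}" for c
  proof -
    have "(\<lambda>i. {g i, g ((i + c) mod 8)}) ` {..<8} = (\<lambda>i. {g i, g ((i + c) mod 8)}) ` r ` {..<8}"
      by (simp only: r(1))
    then show ?thesis by (simp add: image_image step)
  qed
  have "labelling G (g \<circ> r)"
    unfolding labelling_def
  proof
    show "bij_betw (g \<circ> r) {..<8} (verts G)" using r(2) g by (rule bij_betw_trans)
    show "edges G = (\<lambda>i. {(g \<circ> r) i, (g \<circ> r) ((i + 1) mod 8)}) ` {..<8} \<union>
        (\<lambda>i. {(g \<circ> r) i, (g \<circ> r) ((i + 4) mod 8)}) ` {..<8}"
      unfolding E edges_G84 o_def shift[symmetric] by (simp add: image_Un image_image)
  qed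
  moreover have "(g \<circ> r) 0 = v" using k by (simp add: r_def)
  ultimately show ?thesis by (rule that)
qed

lemma lessThan_8: "{..<8::nat} = {0, 1, 2, 3, 4, 5, 6, 7}"
  by auto

lemma disjoint3_cases:
  assumes "A \<inter> B = {}" "A \<inter> C = {}" "B \<inter> C = {}"
  obtains "A \<inter> {e} = {}" "B \<inter> {e} = {}" | "A \<inter> {e} = {}" "C \<inter> {e} = {}"
    | "B \<inter> {e} = {}" "C \<inter> {e} = {}"
  using assms by blast

locale labelled =
  fixes G :: "'a ugraph" and f
  assumes lab: "labelling G f"
begin

lemma verts_eq: "verts G = {f 0, f 1, f 2, f 3, f 4, f 5, f 6, f 7}"
  using lab unfolding labelling_def bij_betw_def lessThan_8 by auto

lemma edges_eq: "edges G =
   {{f 0, f 1}, {f 1, f 2}, {f 2, f 3}, {f 3, f 4}, {f 4, f 5}, {f 5, f 6}, {f 6, f 7}, {f 7, f 0},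
    {f 0, f 4}, {f 1, f 5}, {f 2, f 6}, {f 3, f 7}}"
  using lab unfolding labelling_def lessThan_8 by (simp add: insert_commute del: One_nat_def)

lemma f_eq: "\<lbrakk>i < 8; j < 8\<rbrakk> \<Longrightarrow> f i = f j \<longleftrightarrow> i = j"
  using lab unfolding labelling_def bij_betw_def inj_on_def by auto

lemma wf: "wf_graph G"
  unfolding wf_graph_def edges_eq verts_eq by (simp add: f_eq)

lemma degree: "card {e \<in> edges G. f 0 \<in> e} \<le> 3"
proof -
  have "{e \<in> edges G. f 0 \<in> e} \<subseteq> set [{f 0, f 1}, {f 7, f 0}, {f 0, f 4}]"
    unfolding edges_eq by (auto simp: f_eq)
  then have "card {e \<in> edges G. f 0 \<in> e} \<le> card (set [{f 0, f 1}, {f 7, f 0}, {f 0, f 4}])"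
    by (intro card_mono) simp_all
  also have "\<dots> \<le> length [{f 0, f 1}, {f 7, f 0}, {f 0, f 4}]" by (rule card_length)
  finally show ?thesis by simp
qed

text \<open>A list of weighted label pairs serves as a certificate; injectivity of \<open>f\<close>
  on labels reduces its vertex sums to arithmetic on numbers.\<close>

lemma goodI:
  fixes L :: "(real \<times> nat \<times> nat) list"
  assumes L: "\<And>c i j. (c, i, j) \<in> set L \<Longrightarrow> 0 \<le> c \<and> i < 8 \<and> j < 8 \<and> i \<noteq> j \<and> {f i, f j} \<in> edges G - Y"
    and sum: "\<And>i. i < 8 \<Longrightarrow> (\<Sum>(c, p, q)\<leftarrow>L. if i = p \<or> i = q then c else 0) = of_bool (f i \<notin> X)"
  shows "good G X Y"
  unfolding good_def
proof (rule realizable_cong)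
  let ?L = "map (\<lambda>(c, i, j). (c, f i, f j)) L"
  have V: "f i \<in> verts G" if "i < 8" for i
    using that lab by (auto simp: labelling_def bij_betw_def)
  show "realizable (verts G) (edges G - Y) (\<lambda>x. \<Sum>(c, u, v)\<leftarrow>?L. if x = u \<or> x = v then c else 0)"
  proof (rule realizable_edge_list)
    show "finite (verts G)" by (simp add: verts_eq)
    fix c u v assume "(c, u, v) \<in> set ?L"
    then obtain i j where ij: "(c, i, j) \<in> set L" "u = f i" "v = f j" by auto
    then show "0 \<le> c \<and> u \<in> verts G \<and> v \<in> verts G \<and> u \<noteq> v \<and> {u, v} \<in> edges G - Y"
      using L[OF ij(1)] V by (simp add: f_eq)
  qed
  fix x assume "x \<in> verts G"
  moreover have "f ` {..<8} = verts G" using lab by (simp add: labelling_def bij_betw_def)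
  ultimately have "x \<in> f ` {..<8}" by simp
  then obtain i where i: "i < 8" "x = f i" by auto
  have "(\<Sum>(c, u, v)\<leftarrow>?L. if f i = u \<or> f i = v then c else 0) =
        (\<Sum>(c, p, q)\<leftarrow>L. if i = p \<or> i = q then c else 0)"
    unfolding map_map
  proof (rule arg_cong[of _ _ sum_list], rule map_cong[OF refl])
    fix z assume z: "z \<in> set L"
    obtain c p q where "z = (c, p, q)" by (cases z)
    with L[of c p q] z i(1) show "((\<lambda>(c, u, v). if f i = u \<or> f i = v then c else 0) \<circ> (\<lambda>(c, i, j). (c, f i, f j))) z =
      (case z of (c, p, q) \<Rightarrow> if i = p \<or> i = q then c else 0)"
      by (simp add: f_eq)
  qed
  then show "(\<Sum>(c, u, v)\<leftarrow>?L. if x = u \<or> x = v then c else 0) = of_bool (x \<notin> X)"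
    using sum[OF i(1)] by (simp add: i(2))
qed

lemma good_by_weights:
  fixes L :: "(real \<times> nat \<times> nat) list"
  assumes "\<forall>(c, i, j)\<in>set L. 0 \<le> c \<and> i < 8 \<and> j < 8 \<and> i \<noteq> j \<and> {f i, f j} \<in> edges G - Y"
    and "\<forall>i\<in>{0, 1, 2, 3, 4, 5, 6, 7}.
      (\<Sum>(c, p, q)\<leftarrow>L. if i = p \<or> i = q then c else 0) = of_bool (f i \<notin> X)"
  shows "good G X Y"
  using assms unfolding lessThan_8[symmetric] by (intro goodI[of L]) auto

section \<open>Certificates for at most two faults in G(8,4)\<close>

lemma good_vertex: "good G {f 0} {}"
  \<comment> \<open>Seven vertices remain, an odd number: half weights go on the 5-cycle 1, 2, 3, 4,
    5 closed by the chord from 1 to 5, and weight 1 on the edge from 6 to 7.\<close>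
  by (rule good_by_weights[of
        "[(1/2, 1, 2), (1/2, 2, 3), (1/2, 3, 4), (1/2, 4, 5), (1/2, 1, 5), (1, 6, 7)]"])
     (simp_all add: f_eq edges_eq)

lemma good_two_vertices:
  assumes "d \<in> {1, 2, 3, 4, 5, 6, 7}"
  shows "good G {f d, f 0} {}"
proof -
  have "good G {f 1, f 0} {}"
    by (rule good_by_weights[of "[(1, 2, 3), (1, 4, 5), (1, 6, 7)]"]) (simp_all add: f_eq edges_eq)
  moreover have "good G {f 2, f 0} {}"
    by (rule good_by_weights[of "[(1, 1, 5), (1, 3, 4), (1, 6, 7)]"]) (simp_all add: f_eq edges_eq)
  moreover have "good G {f 3, f 0} {}"
    by (rule good_by_weights[of "[(1, 1, 2), (1, 4, 5), (1, 6, 7)]"]) (simp_all add: f_eq edges_eq)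
  moreover have "good G {f 4, f 0} {}"
    by (rule good_by_weights[of "[(1, 1, 2), (1, 3, 7), (1, 5, 6)]"]) (simp_all add: f_eq edges_eq)
  moreover have "good G {f 5, f 0} {}"
    by (rule good_by_weights[of "[(1, 1, 2), (1, 3, 4), (1, 6, 7)]"]) (simp_all add: f_eq edges_eq)
  moreover have "good G {f 6, f 0} {}"
    by (rule good_by_weights[of "[(1, 1, 2), (1, 3, 7), (1, 4, 5)]"]) (simp_all add: f_eq edges_eq)
  moreover have "good G {f 7, f 0} {}"
    by (rule good_by_weights[of "[(1, 1, 2), (1, 3, 4), (1, 5, 6)]"]) (simp_all add: f_eq edges_eq)
  ultimately show ?thesis using assms by auto
qed

text \<open>G(8,4) splits into three perfect matchings. Dropping from each its edge at 0 leaves a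
  perfect matching of the graph without 0 and one of its neighbours 1, 4, 7. These are disjoint, so
  \<open>e\<close> spoils at most one and two repairs remain.\<close>

lemma nearly_good_vertex_edge: "nearly_good G {f 0} {e}"
proof -
  let ?A = "{{f 2, f 3}, {f 4, f 5}, {f 6, f 7}}"
  let ?B = "{{f 1, f 5}, {f 2, f 6}, {f 3, f 7}}"
  let ?C = "{{f 1, f 2}, {f 3, f 4}, {f 5, f 6}}"
  have A: "good G {f 1, f 0} Y" if "?A \<inter> Y = {}" for Y
    using that by (intro good_by_weights[of "[(1, 2, 3), (1, 4, 5), (1, 6, 7)]"]) (simp_all add: f_eq edges_eq)
  have B: "good G {f 4, f 0} Y" if "?B \<inter> Y = {}" for Y
    using that by (intro good_by_weights[of "[(1, 1, 5), (1, 2, 6), (1, 3, 7)]"]) (simp_all add: f_eq edges_eq)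
  have C: "good G {f 7, f 0} Y" if "?C \<inter> Y = {}" for Y
    using that by (intro good_by_weights[of "[(1, 1, 2), (1, 3, 4), (1, 5, 6)]"]) (simp_all add: f_eq edges_eq)
  have "?A \<inter> ?B = {}" "?A \<inter> ?C = {}" "?B \<inter> ?C = {}"
    by (simp_all add: doubleton_eq_iff f_eq)
  with disjoint3_cases[of ?A ?B ?C e] consider "?A \<inter> {e} = {}" "?B \<inter> {e} = {}" | "?A \<inter> {e} = {}" "?C \<inter> {e} = {}"
    | "?B \<inter> {e} = {}" "?C \<inter> {e} = {}"
    by metis
  then show ?thesis
  proof cases
    case 1
    show ?thesis unfolding nearly_good_def
      by (rule exI[of _ "f 1"], rule exI[of _ "f 4"]) (use A[OF 1(1)] B[OF 1(2)] in \<open>simp add: verts_eq f_eq\<close>)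
  next
    case 2
    show ?thesis unfolding nearly_good_def
      by (rule exI[of _ "f 1"], rule exI[of _ "f 7"]) (use A[OF 2(1)] C[OF 2(2)] in \<open>simp add: verts_eq f_eq\<close>)
  next
    case 3
    show ?thesis unfolding nearly_good_def
      by (rule exI[of _ "f 4"], rule exI[of _ "f 7"]) (use B[OF 3(1)] C[OF 3(2)] in \<open>simp add: verts_eq f_eq\<close>)
  qed
qed

text \<open>The two alternating halves of the rim and the set of chords are disjoint perfect
  matchings, and two edges cannot hit all three.\<close>

lemma good_two_edges:
  assumes "finite Y" "card Y \<le> 2"
  shows "good G {} Y"
proof -
  let ?A = "{{f 0, f 1}, {f 2, f 3}, {f 4, f 5}, {f 6, f 7}}"
  let ?B = "{{f 1, f 2}, {f 3, f 4}, {f 5, f 6}, {f 7, f 0}}"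
  let ?C = "{{f 0, f 4}, {f 1, f 5}, {f 2, f 6}, {f 3, f 7}}"
  have A: "good G {} Y" if "?A \<inter> Y = {}"
    using that by (intro good_by_weights[of "[(1, 0, 1), (1, 2, 3), (1, 4, 5), (1, 6, 7)]"]) (simp_all add: edges_eq)
  have B: "good G {} Y" if "?B \<inter> Y = {}"
    using that by (intro good_by_weights[of "[(1, 1, 2), (1, 3, 4), (1, 5, 6), (1, 7, 0)]"]) (simp_all add: edges_eq)
  have C: "good G {} Y" if "?C \<inter> Y = {}"
    using that by (intro good_by_weights[of "[(1, 0, 4), (1, 1, 5), (1, 2, 6), (1, 3, 7)]"]) (simp_all add: edges_eq)
  have disjoint: "?A \<inter> ?B = {}" "?A \<inter> ?C = {}" "?B \<inter> ?C = {}"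
    by (simp_all add: doubleton_eq_iff f_eq)
  show ?thesis
  proof (rule ccontr)
    assume "\<not> good G {} Y"
    then obtain a b c where abc: "a \<in> ?A \<inter> Y" "b \<in> ?B \<inter> Y" "c \<in> ?C \<inter> Y"
      using A B C by (metis all_not_in_conv)
    then have "a \<noteq> b" "a \<noteq> c" "b \<noteq> c" using disjoint by (metis IntD1 IntI empty_iff)+
    then have "card {a, b, c} = 3" by simp
    moreover have "card {a, b, c} \<le> card Y" using abc assms(1) by (intro card_mono) blast+
    ultimately show False using assms(2) by simp
  qed
qed

end

lemma nearly_robust_G84:
  assumes iso: "isomorphic G84 G"
  shows "nearly_robust G 2"
  unfolding nearly_robust_def
proof (intro allI impI)
  fix X Y assume X: "X \<subseteq> verts G" and Y: "Y \<subseteq> edges G" and card: "card X + card Y \<le> 2"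
  have "0 \<in> verts G84" by (simp add: G84_def)
  then obtain v0 where v0: "v0 \<in> verts G" using iso by (auto simp: isomorphic_def bij_betw_def)
  obtain f0 where "labelling G f0" using labelling_at[OF iso v0] by blast
  then interpret L0: labelled G f0 by unfold_locales
  have finX: "finite X" using X L0.wf finite_subset by (auto simp: wf_graph_def)
  have finY: "finite Y" using Y wf_graph_finite_edges[OF L0.wf] finite_subset by blast
  show "good G X Y \<or> card X = 1 \<and> card Y = 2 - 1 \<and> nearly_good G X Y"
  proof (cases "X = {}")
    case True
    then show ?thesis using L0.good_two_edges[OF finY] card by simp
  next
    case False
    then obtain v where v: "v \<in> X" by blast
    then obtain f where "labelling G f" and f0: "f 0 = v" using labelling_at[OF iso] X by blast
    then interpret L: labelled G f by unfold_locales
    have cX: "card X = Suc (card (X - {v}))" using finX v by (rule card.remove)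
    consider "card (X - {v}) = 0" "card Y = 0" | "card (X - {v}) = 0" "card Y = 1"
      | "card (X - {v}) = 1" "card Y = 0"
      using card unfolding cX by (cases "card Y = 0"; cases "card (X - {v}) = 0") auto
    then show ?thesis
    proof cases
      case 1
      then have "X - {v} = {}" using finX by (simp only: card_0_eq finite_Diff)
      then have "X = {f 0}" "Y = {}" using 1(2) finY v f0 by auto
      then show ?thesis using L.good_vertex by simp
    next
      case 2
      then have "X - {v} = {}" using finX by (simp only: card_0_eq finite_Diff)
      then have "X = {f 0}" using v f0 by auto
      moreover obtain e where "Y = {e}" using 2(2) by (rule card_1_singletonE)
      ultimately show ?thesis using L.nearly_good_vertex_edge by simp
    next
      case 3
      obtain u where u: "X - {v} = {u}" using 3(1) by (rule card_1_singletonE)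
      then have "u \<in> verts G" "u \<noteq> f 0" using X f0 by auto
      then obtain d where "d \<in> {1, 2, 3, 4, 5, 6, 7}" "u = f d" unfolding L.verts_eq by auto
      moreover have "X = {u, f 0}" using u v f0 by auto
      moreover have "Y = {}" using 3(2) finY by simp
      ultimately show ?thesis using L.good_two_vertices by simp
    qed
  qed
qed


section \<open>Restricted hypercube-like graphs\<close>

text \<open>Near robustness is what passes from level to level; full robustness from dimension 5 on
  is read off from the near robustness of the halves.\<close>

lemma RHL_properties:
  assumes "RHL m G"
  shows "3 \<le> m \<and> wf_graph G \<and> verts G \<noteq> {} \<and>
    (\<forall>v\<in>verts G. card {e \<in> edges G. v \<in> e} \<le> m) \<and>
    nearly_robust G (m - 1) \<and> (5 \<le> m \<longrightarrow> robust G (m - 1))"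
  using assms
proof (induction rule: RHL.induct)
  case (base G)
  have "0 \<in> verts G84" by (simp add: G84_def)
  then obtain v0 where v0: "v0 \<in> verts G" using base by (auto simp: isomorphic_def bij_betw_def)
  obtain f0 where "labelling G f0" using labelling_at[OF base v0] by blast
  then interpret L0: labelled G f0 by unfold_locales
  have "card {e \<in> edges G. v \<in> e} \<le> 3" if v: "v \<in> verts G" for v
  proof -
    obtain f where "labelling G f" and f0: "f 0 = v" using labelling_at[OF base v] by blast
    then interpret L: labelled G f by unfold_locales
    show ?thesis using L.degree by (simp add: f0)
  qed
  then show ?case using nearly_robust_G84[OF base] L0.wf v0 by auto
next
  case (step m G0 G1 \<phi>)
  interpret joined G0 G1 \<phi> using step by unfold_locales auto
  define k where "k = m - 1"
  have k: "2 \<le> k" "m = Suc k" using step.IH by (auto simp: k_def)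
  have nr: "nearly_robust G0 k" "nearly_robust G1 k" using step.IH by (auto simp: k_def)
  have "card {e \<in> edges H. v \<in> e} \<le> Suc m" if "v \<in> verts H" for v
  proof (cases "v \<in> verts G0")
    case True
    then show ?thesis using step.IH by (intro degree_join) auto
  next
    case False
    then have "v \<in> verts G1" using that by (simp add: verts_H)
    then show ?thesis
      using step.IH joined.degree_join[OF flip, unfolded flip_graph] by blast
  qed
  moreover have "robust H m" if "5 \<le> Suc m" using robust_join[OF _ nr] that k by simp
  ultimately show ?case
    using nearly_robust_join[OF k(1) nr] wf_H step.IH k by (auto simp: verts_H)
qed

section \<open>Lower and upper bounds for the size of FSMP sets\<close>

lemma robust_FSMP_set:
  assumes wf: "wf_graph G" and "robust G k" and F: "finite F" "FSMP_set G F"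
  shows "k < card F"
proof (rule ccontr)
  assume le: "\<not> k < card F"
  let ?X = "{v. Inl v \<in> F}" and ?Y = "{e. Inr e \<in> F}"
  have F_eq: "F = ?X <+> ?Y"
  proof (rule set_eqI)
    fix z show "z \<in> F \<longleftrightarrow> z \<in> ?X <+> ?Y" by (cases z) auto
  qed
  then have "finite (?X <+> ?Y)" using F(1) by simp
  then have "finite ?X" "finite ?Y" by (simp_all add: finite_Plus_iff)
  then have "card F = card ?X + card ?Y" using F_eq card_Plus[of ?X ?Y] by simp
  moreover have "?X \<subseteq> verts G" "?Y \<subseteq> edges G" using F(2) by (auto simp: FSMP_set_def)
  ultimately have "good G ?X ?Y" using assms(2) le by (simp add: robust_def)
  then show False
    using good_imp_fractional_perfect_matching[OF wf] F(2) by (auto simp: FSMP_set_def)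
qed

lemma FSMP_set_incident_edges:
  assumes "v \<in> verts G"
  shows "FSMP_set G (Inr ` {e \<in> edges G. v \<in> e})"
proof -
  let ?F = "Inr ` {e \<in> edges G. v \<in> e} :: ('a + 'a set) set"
  have "v \<in> verts (delete G ?F)" "{e \<in> edges (delete G ?F). v \<in> e} = {}"
    using assms by (auto simp: delete_def)
  \<comment> \<open>The vertex \<open>v\<close> survives with no edges, so its sum is 0 instead of
    1.\<close>
  then have "\<not> fractional_perfect_matching (delete G ?F) f" for f
    by (auto simp: fractional_perfect_matching_def simp del: Collect_empty_eq intro!: bexI[of _ v])
  moreover have "?F \<subseteq> verts G <+> edges G" by auto
  ultimately show ?thesis by (simp add: FSMP_set_def)
qed

theorem theorem3p7:
  fixes m :: nat and G :: "'a ugraph"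
  assumes "5 \<le> m" and "RHL m G"
  shows "fsmp G = m"
proof -
  have wf: "wf_graph G" and rob: "robust G (m - 1)"
    and deg: "\<And>v. v \<in> verts G \<Longrightarrow> card {e \<in> edges G. v \<in> e} \<le> m"
    using RHL_properties[OF assms(2)] assms(1) by auto
  obtain v where v: "v \<in> verts G" using RHL_properties[OF assms(2)] by blast
  have lower: "m \<le> card F" if "finite F" "FSMP_set G F" for F
    using robust_FSMP_set[OF wf rob that] by simp
  let ?F = "Inr ` {e \<in> edges G. v \<in> e} :: ('a + 'a set) set"
  have F: "finite ?F" "FSMP_set G ?F"
    using wf_graph_finite_edges[OF wf] FSMP_set_incident_edges[OF v] by auto
  moreover have "card ?F \<le> m" using deg[OF v] by (simp add: card_image)
  \<comment> \<open>The degree bound gives one inequality, and the lower bound applied to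
    \<open>?F\<close> itself gives the other.\<close>
  ultimately have "card ?F = m" using lower[OF F] by simp
  with F show ?thesis
    unfolding fsmp_def using lower by (intro Least_equality) blast+
qed

end
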